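(* There is an algorithm that, given a finite, simple, undirected, connected graph $G$, a vertex $r\in V(G)$ and a partial order $\pi$ on $V(G)$, runs in time $O(|V(G)|+|E(G)|+|\pi|)$ and either outputs a Generic Search ordering of $G$ starting in $r$ that is a linear extension of $\pi$, or correctly reports that no such ordering exists.
   Context: A Generic Search (GS) ordering of $G$ is a vertex ordering $\sigma$ (a bijection $\{1,\dots,|V(G)|\}\to V(G)$) in which every vertex except $\sigma(1)$ has a neighbor that appears before it in $\sigma$. A linear extension of a partial order $\pi$ is a total order $\sigma$ such that $(x,y)\in\pi$ with $x\neq y$ implies $x$ appears before $y$ in $\sigma$. $|\pi|$ denotes the number of pairs in $\pi$. *)

theory Defs
  imports "Graph_Theory.Graph_Theory"
begin

section \<open>Generic Search orderings and linear extensions\<close>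

text \<open>
  A finite simple undirected graph is a \<^const>\<open>pair_graph\<close>: a finite, loop-free set of pairs that
  contains both orientations of each edge. An undirected edge is therefore counted once by
  \<open>card (uedges G)\<close>, but twice by the cardinality of \<open>parcs G\<close>.
\<close>

definition uedges :: "'v pair_pre_digraph \<Rightarrow> 'v set set" where
  "uedges G = {{u, v} | u v. (u, v) \<in> parcs G}"

definition vertex_ordering :: "'v pair_pre_digraph \<Rightarrow> (nat \<Rightarrow> 'v) \<Rightarrow> bool" where
  "vertex_ordering G \<sigma> \<longleftrightarrow> bij_betw \<sigma> {1..card (pverts G)} (pverts G)"

definition GS_ordering :: "'v pair_pre_digraph \<Rightarrow> (nat \<Rightarrow> 'v) \<Rightarrow> bool" where
  "GS_ordering G \<sigma> \<longleftrightarrow> vertex_ordering G \<sigma> \<and>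
     (\<forall>i\<in>{2..card (pverts G)}. \<exists>j\<in>{1..<i}. (\<sigma> j, \<sigma> i) \<in> parcs G)"

definition linear_extension :: "'v pair_pre_digraph \<Rightarrow> 'v rel \<Rightarrow> (nat \<Rightarrow> 'v) \<Rightarrow> bool" where
  "linear_extension G \<pi> \<sigma> \<longleftrightarrow> vertex_ordering G \<sigma> \<and>
     (\<forall>i\<in>{1..card (pverts G)}. \<forall>j\<in>{1..card (pverts G)}.
        (\<sigma> i, \<sigma> j) \<in> \<pi> \<and> \<sigma> i \<noteq> \<sigma> j \<longrightarrow> i < j)"

section \<open>A random access machine\<close>

text \<open>
  The machine has named scalar registers and named arrays of natural numbers, with indirect
  addressing into the arrays. Every instruction and every evaluation of a test costs one time unit.
  The only arithmetic is increment and decrement. Hence in a run of \<open>t\<close> steps no number exceeds the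
  largest input number or program constant by more than \<open>t\<close>, and the unit-cost measure cannot be
  exploited by building long numbers: a linear-time run only handles words of logarithmic length.
\<close>

datatype operand = Const nat | Reg string

datatype test = Eq operand operand | Less operand operand

datatype prog =
    Skip
  | Set string operand
  | Incr string
  | Decr string
  | Read string string operand    \<comment> \<open>\<open>Read x a i\<close> is \<open>x := a[i]\<close>\<close>
  | Write string operand operand  \<comment> \<open>\<open>Write a i e\<close> is \<open>a[i] := e\<close>\<close>
  | Seq prog prog
  | If test prog prog
  | While test prog

record mstate =
  regs :: "string \<Rightarrow> nat"
  arrs :: "string \<Rightarrow> nat \<Rightarrow> nat"

primrec operand_val :: "mstate \<Rightarrow> operand \<Rightarrow> nat" where
  "operand_val s (Const k) = k"
| "operand_val s (Reg x) = regs s x"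

primrec test_val :: "mstate \<Rightarrow> test \<Rightarrow> bool" where
  "test_val s (Eq e f) \<longleftrightarrow> operand_val s e = operand_val s f"
| "test_val s (Less e f) \<longleftrightarrow> operand_val s e < operand_val s f"

definition set_reg :: "string \<Rightarrow> nat \<Rightarrow> mstate \<Rightarrow> mstate" where
  "set_reg x k s = s\<lparr>regs := (regs s)(x := k)\<rparr>"

definition set_cell :: "string \<Rightarrow> nat \<Rightarrow> nat \<Rightarrow> mstate \<Rightarrow> mstate" where
  "set_cell a i k s = s\<lparr>arrs := (arrs s)(a := (arrs s a)(i := k))\<rparr>"

text \<open>
  \<open>exec P s t s'\<close>: started in state \<open>s\<close>, the program \<open>P\<close> halts after exactly \<open>t\<close> steps in state \<open>s'\<close>.
\<close>

inductive exec :: "prog \<Rightarrow> mstate \<Rightarrow> nat \<Rightarrow> mstate \<Rightarrow> bool" where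
  Skip: "exec Skip s 1 s"
| Set: "exec (Set x e) s 1 (set_reg x (operand_val s e) s)"
| Incr: "exec (Incr x) s 1 (set_reg x (regs s x + 1) s)"
| Decr: "exec (Decr x) s 1 (set_reg x (regs s x - 1) s)"
| Read: "exec (Read x a e) s 1 (set_reg x (arrs s a (operand_val s e)) s)"
| Write: "exec (Write a e f) s 1 (set_cell a (operand_val s e) (operand_val s f) s)"
| Seq: "exec P s t s' \<Longrightarrow> exec Q s' u s'' \<Longrightarrow> exec (Seq P Q) s (t + u) s''"
| IfTrue: "test_val s b \<Longrightarrow> exec P s t s' \<Longrightarrow> exec (If b P Q) s (1 + t) s'"
| IfFalse: "\<not> test_val s b \<Longrightarrow> exec Q s t s' \<Longrightarrow> exec (If b P Q) s (1 + t) s'"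
| WhileFalse: "\<not> test_val s b \<Longrightarrow> exec (While b P) s 1 s"
| WhileTrue: "test_val s b \<Longrightarrow> exec P s t s' \<Longrightarrow> exec (While b P) s' u s'' \<Longrightarrow>
    exec (While b P) s (1 + t + u) s''"

lemma exec_deterministic:
  "exec P s t s' \<Longrightarrow> exec P s u s'' \<Longrightarrow> u = t \<and> s'' = s'"
proof (induction arbitrary: u s'' rule: exec.induct)
  case (Seq P s t s1 Q v s2)
  from Seq.prems show ?case by cases (use Seq.IH in blast)
next
  case (IfTrue s b P t s1 Q)
  from IfTrue.prems show ?case by cases (use IfTrue.IH IfTrue.hyps in blast)+
next
  case (IfFalse s b Q t s1 P)
  from IfFalse.prems show ?case by cases (use IfFalse.IH IfFalse.hyps in blast)+
next
  case (WhileTrue s b P t s1 v s2)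
  from WhileTrue.prems show ?case by cases (use WhileTrue.IH WhileTrue.hyps in blast)+
qed (erule exec.cases; simp)+

section \<open>Inputs and outputs of the machine\<close>

text \<open>
  The machine sees vertices as the numbers \<open>0, \<dots>, |V(G)| - 1\<close>; the list \<open>vs\<close> says which vertex a number
  stands for and is not itself part of the input. The graph is given as the list \<open>es\<close> of its
  edges, each listed once, in any order and either orientation, and \<open>\<pi>\<close> as the list \<open>ps\<close> of its
  pairs (including the reflexive ones), each listed once and in any order.
\<close>

definition encodes :: "'v list \<Rightarrow> (nat \<times> nat) list \<Rightarrow> nat \<Rightarrow> (nat \<times> nat) list \<Rightarrow>
    'v pair_pre_digraph \<Rightarrow> 'v \<Rightarrow> 'v rel \<Rightarrow> bool" where
  "encodes vs es k ps G r \<pi> \<longleftrightarrow>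
     distinct vs \<and> set vs = pverts G \<and>
     set es \<subseteq> {..<length vs} \<times> {..<length vs} \<and>
     distinct (map (\<lambda>(i, j). {vs ! i, vs ! j}) es) \<and>
     (\<lambda>(i, j). {vs ! i, vs ! j}) ` set es = uedges G \<and>
     k < length vs \<and> vs ! k = r \<and>
     set ps \<subseteq> {..<length vs} \<times> {..<length vs} \<and>
     distinct ps \<and>
     (\<lambda>(i, j). (vs ! i, vs ! j)) ` set ps = \<pi>"

definition cells :: "nat list \<Rightarrow> nat \<Rightarrow> nat" where
  "cells xs i = (if i < length xs then xs ! i else 0)"

definition initial_state ::
  "nat \<Rightarrow> (nat \<times> nat) list \<Rightarrow> nat \<Rightarrow> (nat \<times> nat) list \<Rightarrow> mstate" where
  "initial_state n es k ps =
     \<lparr>regs = (\<lambda>_. 0)(''n'' := n, ''m'' := length es, ''p'' := length ps, ''r'' := k),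
      arrs = (\<lambda>_ _. 0)(''edge_fst'' := cells (map fst es), ''edge_snd'' := cells (map snd es),
                       ''order_fst'' := cells (map fst ps), ''order_snd'' := cells (map snd ps))\<rparr>"

text \<open>
  On halting, register \<open>found\<close> tells whether an ordering was found; if so, cells \<open>1, \<dots>, |V(G)|\<close> of the
  array \<open>sigma\<close> hold the numbers of its vertices.
\<close>

definition reports_none :: "mstate \<Rightarrow> bool" where
  "reports_none s \<longleftrightarrow> regs s ''found'' = 0"

definition outputs :: "mstate \<Rightarrow> 'v list \<Rightarrow> (nat \<Rightarrow> 'v) \<Rightarrow> bool" where
  "outputs s vs \<sigma> \<longleftrightarrow> regs s ''found'' = 1 \<and>
     (\<forall>i\<in>{1..length vs}. arrs s ''sigma'' i < length vs \<and> \<sigma> i = vs ! arrs s ''sigma'' i)"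

end

theory Submission
  imports Defs
begin

text \<open>
  Greedy search: repeatedly append any vertex that has an already processed neighbour (or is \<open>r\<close>) and
  whose \<open>\<pi>\<close>-predecessors have all been processed. Both conditions persist once they hold. So if the
  search gets stuck with the set \<open>S \<noteq> V(G)\<close>, then the first vertex outside \<open>S\<close> of a valid ordering would
  be eligible, a contradiction. Keeping a mark and a counter of unprocessed predecessors per vertex,
  every edge and every pair of \<open>\<pi>\<close> is scanned a bounded number of times, and a vertex is eligible exactly
  from the moment its mark is set and its counter is zero. The output array serves as the queue.
\<close>

section \<open>Timed weakest preconditions\<close>

text \<open>Total correctness with time: as \<open>exec\<close> is deterministic, one halting run
  satisfying \<open>Q\<close> is the only run. Passing the step count to \<open>Q\<close> lets cost
  and effect be proved together.\<close>

definition runs :: "prog \<Rightarrow> mstate \<Rightarrow> (nat \<Rightarrow> mstate \<Rightarrow> bool) \<Rightarrow> bool" where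
  "runs P s Q \<longleftrightarrow> (\<exists>t s'. exec P s t s' \<and> Q t s')"

inductive_cases exec_elims:
  "exec Skip s t s'" "exec (Set x e) s t s'" "exec (Incr x) s t s'" "exec (Decr x) s t s'"
  "exec (Read x a e) s t s'" "exec (Write a e f) s t s'" "exec (Seq P Q) s t s'"
  "exec (If b P Q) s t s'"

lemma runs_simps:
  "runs Skip s R \<longleftrightarrow> R 1 s"
  "runs (Set x e) s R \<longleftrightarrow> R 1 (set_reg x (operand_val s e) s)"
  "runs (Incr x) s R \<longleftrightarrow> R 1 (set_reg x (regs s x + 1) s)"
  "runs (Decr x) s R \<longleftrightarrow> R 1 (set_reg x (regs s x - 1) s)"
  "runs (Read x a e) s R \<longleftrightarrow> R 1 (set_reg x (arrs s a (operand_val s e)) s)"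
  "runs (Write a e f) s R \<longleftrightarrow> R 1 (set_cell a (operand_val s e) (operand_val s f) s)"
  "runs (Seq P Q) s R \<longleftrightarrow> runs P s (\<lambda>t s'. runs Q s' (\<lambda>u. R (t + u)))"
  "runs (If b P Q) s R \<longleftrightarrow>
     (if test_val s b then runs P s (\<lambda>t. R (1 + t)) else runs Q s (\<lambda>t. R (1 + t)))"
  unfolding runs_def by (cases "test_val s b"; fastforce intro: exec.intros elim: exec_elims)+

lemma runs_mono:
  assumes "runs P s Q" and "\<And>t s'. Q t s' \<Longrightarrow> R t s'"
  shows "runs P s R"
  using assms unfolding runs_def by blast

lemma runs_While:
  fixes \<Phi> :: "mstate \<Rightarrow> nat"
  assumes "I s"
    and step: "\<And>s. I s \<Longrightarrow> test_val s b \<Longrightarrow> runs P s (\<lambda>t s'. I s' \<and> t + 1 + \<Phi> s' \<le> \<Phi> s)"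
  shows "runs (While b P) s (\<lambda>t s'. I s' \<and> \<not> test_val s' b \<and> t + \<Phi> s' \<le> \<Phi> s + 1)"
  using \<open>I s\<close>
proof (induction "\<Phi> s" arbitrary: s rule: less_induct)
  case less
  show ?case
  proof (cases "test_val s b")
    case True
    from step[OF less.prems True] obtain t s1
      where 1: "exec P s t s1" "I s1" "t + 1 + \<Phi> s1 \<le> \<Phi> s"
      unfolding runs_def by blast
    then have "\<Phi> s1 < \<Phi> s" by simp
    from less.hyps[OF this \<open>I s1\<close>] obtain u s2
      where 2: "exec (While b P) s1 u s2" "I s2" "\<not> test_val s2 b" "u + \<Phi> s2 \<le> \<Phi> s1 + 1"
      unfolding runs_def by blast
    from exec.WhileTrue[OF True 1(1) 2(1)] 1(3) 2 show ?thesis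
      unfolding runs_def by (intro exI conjI) (assumption | simp)+
  next
    case False
    with less.prems show ?thesis
      unfolding runs_def by (intro exI conjI) (rule exec.WhileFalse | simp)+
  qed
qed

lemma set_simps [simp]:
  "regs (set_reg x k s) = (regs s)(x := k)" "arrs (set_reg x k s) = arrs s"
  "regs (set_cell a i k s) = regs s"
  "arrs (set_cell a i k s) = (arrs s)(a := (arrs s a)(i := k))"
  by (simp_all add: set_reg_def set_cell_def)

section \<open>Linked lists of arcs\<close>

text \<open>
  An arc \<open>(u, w, c)\<close> is an orientation of an edge if \<open>c\<close> is false, and a pair of the partial order if
  \<open>c\<close> is true.
\<close>

type_synonym arc = "nat \<times> nat \<times> bool"

abbreviation src :: "arc \<Rightarrow> nat" where "src \<equiv> fst"
abbreviation tgt :: "arc \<Rightarrow> nat" where "tgt x \<equiv> fst (snd x)"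
abbreviation constr :: "arc \<Rightarrow> bool" where "constr x \<equiv> snd (snd x)"

text \<open>The list is read latest arc first, so \<open>Suc (length xs)\<close> is the shifted
  position of \<open>x\<close> in the order of insertion.\<close>

primrec newest :: "arc list \<Rightarrow> nat \<Rightarrow> nat" where
  "newest [] v = 0"
| "newest (x # xs) v = (if src x = v then Suc (length xs) else newest xs v)"

text \<open>Pointers are indices shifted by one; \<open>0\<close> is the null pointer.\<close>

definition link :: "arc list \<Rightarrow> nat \<Rightarrow> nat" where
  "link L = newest (rev L)"

lemma link_Nil [simp]: "link [] v = 0"
  by (simp add: link_def)

lemma link_snoc [simp]: "link (L @ [x]) v = (if src x = v then Suc (length L) else link L v)"
  by (simp add: link_def)

lemma link_le: "link L v \<le> length L"
  by (induction L rule: rev_induct) auto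

lemma src_link: "link L v \<noteq> 0 \<Longrightarrow> src (L ! (link L v - 1)) = v"
proof (induction L rule: rev_induct)
  case (snoc x L)
  then show ?case using link_le[of L v] by (auto simp: nth_append)
qed simp

text \<open>Together with \<open>src_link\<close> this makes \<open>link L v\<close> the shifted
  index of the last arc leaving \<open>v\<close>; it ensures that a traversal skips no arc of
  \<open>v\<close>.\<close>

lemma src_beyond_link: "link L v \<le> b \<Longrightarrow> b < length L \<Longrightarrow> src (L ! b) \<noteq> v"
proof (induction L rule: rev_induct)
  case (snoc x L)
  then show ?case by (cases "b = length L") (auto simp: nth_append split: if_splits)
qed simp

text \<open>The \<open>next\<close> cell of arc \<open>a\<close> keeps the list head from the moment
  of insertion, which depends only on the arcs before \<open>a\<close>. Indices thus decrease
  strictly along a list, and its unscanned part is described by a threshold.\<close>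

definition linked :: "arc list \<Rightarrow> mstate \<Rightarrow> bool" where
  "linked L s \<longleftrightarrow> regs s ''q'' = length L \<and> arrs s ''head'' = link L \<and>
     (\<forall>a<length L. arrs s ''tgt'' a = tgt (L ! a) \<and> arrs s ''constr'' a = of_bool (constr (L ! a)) \<and>
        arrs s ''next'' a = link (take a L) (src (L ! a)))"

section \<open>The invariant of the search\<close>

text \<open>
  The array \<open>\<sigma>\<close> is a queue: positions \<open>1, \<dots>, t\<close> have been filled, the vertices at positions
  \<open>1, \<dots>, h\<close> have been dequeued, and the arcs leaving \<open>\<sigma> h\<close> are still unscanned below the pointer \<open>e\<close>.
\<close>

definition pend :: "arc list \<Rightarrow> (nat \<Rightarrow> nat) \<Rightarrow> nat \<Rightarrow> nat \<Rightarrow> nat set" where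
  "pend L \<sigma> h e = {a. a < length L \<and> (src (L ! a) \<notin> \<sigma> ` {1..h} \<or> src (L ! a) = \<sigma> h \<and> a < e)}"

text \<open>The order condition asks for membership in the earlier positions instead of comparing
  positions, so that a predecessor missing from the queue also counts as a violation.\<close>

definition prefix_ok :: "arc list \<Rightarrow> nat \<Rightarrow> nat \<Rightarrow> (nat \<Rightarrow> nat) \<Rightarrow> bool" where
  "prefix_ok L r t \<sigma> \<longleftrightarrow> inj_on \<sigma> {1..t} \<and>
     (\<forall>i\<in>{1..t}. (if i = 1 then \<sigma> i = r else \<exists>j\<in>{1..<i}. (\<sigma> j, \<sigma> i, False) \<in> set L) \<and>
       (\<forall>u. (u, \<sigma> i, True) \<in> set L \<longrightarrow> u \<in> \<sigma> ` {1..<i}))"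

text \<open>Arcs outside \<open>pend\<close> are the scanned ones. In the last clause, the direction
  from left to right keeps a queued vertex from being enqueued again; the converse says that no
  eligible vertex is left out, which the case of a stuck search rests on.\<close>

definition search_inv ::
  "arc list \<Rightarrow> nat \<Rightarrow> nat \<Rightarrow> nat \<Rightarrow> nat \<Rightarrow> (nat \<Rightarrow> nat) \<Rightarrow> (nat \<Rightarrow> nat) \<Rightarrow> (nat \<Rightarrow> nat) \<Rightarrow> bool" where
  "search_inv L r h t e \<sigma> mark cnt \<longleftrightarrow>
     h \<le> t \<and> prefix_ok L r t \<sigma> \<and>
     (e \<noteq> 0 \<longrightarrow> h \<noteq> 0 \<and> e \<le> length L \<and> src (L ! (e - 1)) = \<sigma> h) \<and>
     (\<forall>w. mark w \<noteq> 0 \<longleftrightarrow>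
        w = r \<or> (\<exists>a<length L. a \<notin> pend L \<sigma> h e \<and> tgt (L ! a) = w \<and> \<not> constr (L ! a))) \<and>
     (\<forall>w. cnt w = card {a \<in> pend L \<sigma> h e. tgt (L ! a) = w \<and> constr (L ! a)}) \<and>
     (\<forall>w. w \<in> \<sigma> ` {1..t} \<longleftrightarrow> mark w \<noteq> 0 \<and> cnt w = 0)"

lemma finite_pend [simp]: "finite (pend L \<sigma> h e)"
  unfolding pend_def by simp

lemma pend_subset: "pend L \<sigma> h e \<subseteq> {..<length L}"
  unfolding pend_def by auto

text \<open>Dequeuing scans nothing. By injectivity \<open>\<sigma> (Suc h)\<close> was not dequeued
  before, so all its arcs were pending; they remain so because the list head lies above each of
  them. The pointer 0 says that the previous vertex has no unscanned arc left.\<close>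

lemma pend_dequeue:
  assumes "inj_on \<sigma> {1..t}" "h < t"
  shows "pend L \<sigma> (Suc h) (link L (\<sigma> (Suc h))) = pend L \<sigma> h 0"
proof -
  define S where "S = \<sigma> ` {1..h}"
  have "\<sigma> (Suc h) \<notin> S"
    using assms unfolding S_def by (auto dest: inj_onD)
  moreover have "a < link L (\<sigma> (Suc h))" if "a < length L" "src (L ! a) = \<sigma> (Suc h)" for a
    using src_beyond_link[of L "\<sigma> (Suc h)" a] that by (meson not_le)
  moreover have "\<sigma> ` {1..Suc h} = insert (\<sigma> (Suc h)) S"
    unfolding S_def by (simp add: atLeastAtMostSuc_conv)
  ultimately show ?thesis unfolding pend_def S_def[symmetric] by auto
qed

text \<open>The indices below \<open>a\<close> that the next pointer jumps over belong to other
  sources, so one step along the list removes exactly \<open>a\<close>, whose own pointer is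
  \<open>Suc a\<close>.\<close>

lemma pend_next:
  assumes "a < length L" "src (L ! a) = \<sigma> h" "h \<noteq> 0"
  shows "pend L \<sigma> h (link (take a L) (\<sigma> h)) = pend L \<sigma> h (Suc a) - {a}"
    and "a \<in> pend L \<sigma> h (Suc a)"
proof -
  have "b < link (take a L) (\<sigma> h)" if "b < a" "src (L ! b) = \<sigma> h" for b
    using src_beyond_link[of "take a L" "\<sigma> h" b] that assms(1) by (cases "link (take a L) (\<sigma> h) \<le> b") auto
  moreover have "link (take a L) (\<sigma> h) \<le> a"
    using link_le[of "take a L" "\<sigma> h"] assms by simp
  moreover have mem: "\<sigma> h \<in> \<sigma> ` {1..h}" using assms(3) by auto
  ultimately show "pend L \<sigma> h (link (take a L) (\<sigma> h)) = pend L \<sigma> h (Suc a) - {a}"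
    unfolding pend_def using assms(2)
    by (auto simp: less_Suc_eq simp del: image_iff)
  show "a \<in> pend L \<sigma> h (Suc a)" using assms(1,2) unfolding pend_def by simp
qed

lemma pend_enqueue:
  assumes "h \<le> t"
  shows "pend L (\<sigma>(Suc t := w)) h e = pend L \<sigma> h e"
proof -
  have "(\<sigma>(Suc t := w)) ` {1..h} = \<sigma> ` {1..h}" "(\<sigma>(Suc t := w)) h = \<sigma> h"
    using assms by auto
  then show ?thesis unfolding pend_def by simp
qed

lemma search_inv_dequeue:
  assumes "search_inv L r h t 0 \<sigma> mark cnt" "h < t"
  shows "search_inv L r (Suc h) t (link L (\<sigma> (Suc h))) \<sigma> mark cnt"
proof -
  have "pend L \<sigma> (Suc h) (link L (\<sigma> (Suc h))) = pend L \<sigma> h 0"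
    by (rule pend_dequeue) (use assms in \<open>auto simp: search_inv_def prefix_ok_def\<close>)
  then show ?thesis
    using assms link_le[of L "\<sigma> (Suc h)"] src_link[of L "\<sigma> (Suc h)"]
    unfolding search_inv_def by simp
qed

lemma prefix_ok_enqueue:
  assumes ok: "prefix_ok L r t \<sigma>" and "t \<noteq> 0" and new: "w \<notin> \<sigma> ` {1..t}"
    and edge: "\<exists>j\<in>{1..t}. (\<sigma> j, w, False) \<in> set L"
    and preds: "\<And>u. (u, w, True) \<in> set L \<Longrightarrow> u \<in> \<sigma> ` {1..t}"
  shows "prefix_ok L r (Suc t) (\<sigma>(Suc t := w))"
proof -
  define \<tau> where "\<tau> = \<sigma>(Suc t := w)"
  have old: "\<tau> i = \<sigma> i" if "i \<le> t" for i
    using that unfolding \<tau>_def by simp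
  have new_val: "\<tau> (Suc t) = w" unfolding \<tau>_def by simp
  have im: "\<tau> ` A = \<sigma> ` A" if "A \<subseteq> {..t}" for A
    using that old by (intro image_cong) auto
  have "inj_on \<tau> {1..t}"
    using ok old unfolding prefix_ok_def inj_on_def by (metis atLeastAtMost_iff)
  moreover have "w \<notin> \<tau> ` {1..t}" using new im[of "{1..t}"] by auto
  moreover have "{1..Suc t} = insert (Suc t) {1..t}" by auto
  ultimately have "inj_on \<tau> {1..Suc t}"
    using new_val by (simp add: inj_on_insert)
  moreover have "(if i = 1 then \<tau> i = r else \<exists>j\<in>{1..<i}. (\<tau> j, \<tau> i, False) \<in> set L) \<and>
       (\<forall>u. (u, \<tau> i, True) \<in> set L \<longrightarrow> u \<in> \<tau> ` {1..<i})" if i: "i \<in> {1..Suc t}" for i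
  proof (cases "i = Suc t")
    case True
    have "\<exists>j\<in>{1..<i}. (\<tau> j, w, False) \<in> set L"
      using edge old True by (metis atLeastAtMost_iff atLeastLessThan_iff less_Suc_eq_le)
    moreover have "\<tau> ` {1..<i} = \<sigma> ` {1..t}"
      using im[of "{1..t}"] True by (simp add: atLeastLessThanSuc_atLeastAtMost)
    ultimately show ?thesis using preds \<open>t \<noteq> 0\<close> new_val True by simp
  next
    case False
    with i have i': "i \<in> {1..t}" by auto
    with ok have A: "if i = 1 then \<sigma> i = r else \<exists>j\<in>{1..<i}. (\<sigma> j, \<sigma> i, False) \<in> set L"
      and B: "\<forall>u. (u, \<sigma> i, True) \<in> set L \<longrightarrow> u \<in> \<sigma> ` {1..<i}"
      unfolding prefix_ok_def by blast+
    have "\<tau> i = \<sigma> i" using old i' by simp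
    moreover have "\<forall>j\<in>{1..<i}. \<tau> j = \<sigma> j" using old i' by simp
    moreover have "\<tau> ` {1..<i} = \<sigma> ` {1..<i}" by (rule im) (use i' in auto)
    ultimately show ?thesis using A B by (metis (no_types, lifting))
  qed
  ultimately show ?thesis unfolding prefix_ok_def \<tau>_def[symmetric] by blast
qed

text \<open>Scanning one arc can change the eligibility of its target \<open>w\<close> only, and
  \<open>fresh\<close> holds exactly if \<open>w\<close> becomes eligible at this moment. The second
  claim drives the time bound: every scan uses up one pending arc.\<close>

lemma search_inv_scan:
  assumes inv: "search_inv L r h t (Suc a) \<sigma> mark cnt"
    and arc: "L ! a = (u, w, c)"
    and mark': "mark' = (if c then mark else mark(w := 1))"
    and cnt': "cnt' = (if c then cnt(w := cnt w - 1) else cnt)"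
    and fresh: "fresh \<longleftrightarrow> (if c then cnt w - 1 = 0 \<and> mark w \<noteq> 0 else mark w = 0 \<and> cnt w = 0)"
    and t': "t' = (if fresh then Suc t else t)"
    and \<sigma>': "\<sigma>' = (if fresh then \<sigma>(Suc t := w) else \<sigma>)"
  shows "search_inv L r h t' (link (take a L) u) \<sigma>' mark' cnt'"
    and "card (pend L \<sigma> h (Suc a)) = Suc (card (pend L \<sigma>' h (link (take a L) u)))"
proof -
  let ?U = "pend L \<sigma> h (Suc a)" and ?e = "link (take a L) u"
  from inv have ht: "h \<le> t" and ok: "prefix_ok L r t \<sigma>" and h0: "h \<noteq> 0" and a: "a < length L"
    and u: "u = \<sigma> h"
    and mark: "\<And>w. mark w \<noteq> 0 \<longleftrightarrow>
        w = r \<or> (\<exists>a<length L. a \<notin> ?U \<and> tgt (L ! a) = w \<and> \<not> constr (L ! a))"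
    and cnt: "\<And>w. cnt w = card {a \<in> ?U. tgt (L ! a) = w \<and> constr (L ! a)}"
    and queue: "\<And>w. w \<in> \<sigma> ` {1..t} \<longleftrightarrow> mark w \<noteq> 0 \<and> cnt w = 0"
    using arc unfolding search_inv_def by auto
  have arc': "src (L ! a) = u" "tgt (L ! a) = w" "constr (L ! a) = c"
    using arc by simp_all
  have aU: "a \<in> ?U" and U: "pend L \<sigma> h ?e = ?U - {a}"
    using pend_next[of a L \<sigma> h] a arc u h0 by auto
  have U': "pend L \<sigma>' h ?e = ?U - {a}"
    using pend_enqueue[OF ht] U unfolding \<sigma>' by simp
  show "card ?U = Suc (card (pend L \<sigma>' h ?e))"
    unfolding U' by (rule card.remove[OF finite_pend aU])
  have mark1: "mark' x \<noteq> 0 \<longleftrightarrow>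
      x = r \<or> (\<exists>b<length L. b \<notin> ?U - {a} \<and> tgt (L ! b) = x \<and> \<not> constr (L ! b))" for x
  proof (cases c)
    case True
    with arc' mark[of x] show ?thesis unfolding mark' by auto
  next
    case False
    with arc' mark[of x] a show ?thesis unfolding mark' by auto
  qed
  have split: "{b \<in> ?U. tgt (L ! b) = x \<and> constr (L ! b)} =
     (if c \<and> x = w then insert a {b \<in> ?U - {a}. tgt (L ! b) = x \<and> constr (L ! b)}
      else {b \<in> ?U - {a}. tgt (L ! b) = x \<and> constr (L ! b)})" for x
    using arc' aU by auto
  have cnt1: "cnt' x = card {b \<in> ?U - {a}. tgt (L ! b) = x \<and> constr (L ! b)}" for x
    using cnt[of x] split[of x] unfolding cnt' by (auto split: if_splits)
  \<comment> \<open>The order arc \<open>a\<close> is itself still counted by \<open>cnt w\<close>.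
    So the subtraction in \<open>cnt'\<close> is not truncated, and \<open>w\<close> is not yet in
    the queue.\<close>
  have pos: "cnt w \<noteq> 0" if c
    using cnt[of w] split[of w] that by simp
  have fresh_iff: "fresh \<longleftrightarrow> w \<notin> \<sigma> ` {1..t} \<and> mark' w \<noteq> 0 \<and> cnt' w = 0"
    unfolding fresh queue mark' cnt' using pos by auto
  have same: "x \<in> \<sigma> ` {1..t} \<longleftrightarrow> mark' x \<noteq> 0 \<and> cnt' x = 0" if "x \<noteq> w" for x
    unfolding queue mark' cnt' using that by simp
  have stay: "mark' w \<noteq> 0 \<and> cnt' w = 0" if "w \<in> \<sigma> ` {1..t}"
    using that pos unfolding queue mark' cnt' by auto
  have eq: "{1..Suc t} = insert (Suc t) {1..t}" by auto
  have im: "\<sigma>' ` {1..t'} = (if fresh then insert w (\<sigma> ` {1..t}) else \<sigma> ` {1..t})"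
    unfolding \<sigma>' t' eq by auto
  have queue1: "x \<in> \<sigma>' ` {1..t'} \<longleftrightarrow> mark' x \<noteq> 0 \<and> cnt' x = 0" for x
    unfolding im using fresh_iff same[of x] stay by (cases "x = w") auto
  \<comment> \<open>Such an arc is \<open>a\<close> itself, which leaves \<open>\<sigma> h\<close>,
    or it leaves a vertex that has already been dequeued.\<close>
  have scanned: "src (L ! b) \<in> \<sigma> ` {1..t}" if "b < length L" "b \<notin> ?U - {a}" for b
  proof -
    have "\<sigma> h \<in> \<sigma> ` {1..t}" using h0 ht by auto
    moreover have "\<sigma> ` {1..h} \<subseteq> \<sigma> ` {1..t}" using ht by auto
    ultimately show ?thesis using that u arc' unfolding pend_def by auto
  qed
  have ok': "prefix_ok L r t' \<sigma>'"
  proof (cases fresh)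
    case True
    with fresh_iff have f: "w \<notin> \<sigma> ` {1..t}" "mark' w \<noteq> 0" "cnt' w = 0" by auto
    have t0: "t \<noteq> 0" using h0 ht by simp
    \<comment> \<open>Position 1 is taken by \<open>r\<close>, so the mark of a new vertex must come
      from a scanned edge arc; the source of that arc is the earlier neighbour.\<close>
    then have "\<sigma> 1 = r" and "1 \<in> {1..t}" using ok unfolding prefix_ok_def by auto
    with f(1) have "w \<noteq> r" by blast
    with f(2) mark1[of w] obtain b where b: "b < length L" "b \<notin> ?U - {a}" "tgt (L ! b) = w"
      "\<not> constr (L ! b)" by blast
    then have "(src (L ! b), w, False) \<in> set L"
      by (metis (full_types) nth_mem prod.collapse)
    with scanned[OF b(1,2)] have edge: "\<exists>j\<in>{1..t}. (\<sigma> j, w, False) \<in> set L" by auto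
    have preds: "v \<in> \<sigma> ` {1..t}" if "(v, w, True) \<in> set L" for v
    proof -
      from that obtain b where b: "b < length L" "L ! b = (v, w, True)"
        by (auto simp: in_set_conv_nth)
      \<comment> \<open>A zero counter leaves no pending order arc into \<open>w\<close>, so each
        predecessor is the source of a scanned arc.\<close>
      have "{b \<in> ?U - {a}. tgt (L ! b) = w \<and> constr (L ! b)} = {}"
        using f(3) cnt1[of w] by simp
      moreover have "tgt (L ! b) = w" "constr (L ! b)" by (simp_all add: b(2))
      ultimately have "b \<notin> ?U - {a}" by blast
      from scanned[OF b(1) this] b show ?thesis by simp
    qed
    from prefix_ok_enqueue[OF ok t0 f(1) edge preds] True show ?thesis
      unfolding \<sigma>' t' by simp
  next
    case False
    with ok show ?thesis unfolding \<sigma>' t' by simp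
  qed
  have "?e \<noteq> 0 \<Longrightarrow> ?e \<le> length L \<and> src (L ! (?e - 1)) = u"
    using link_le[of "take a L" u] src_link[of "take a L" u] a by simp
  moreover have "\<sigma>' h = \<sigma> h" unfolding \<sigma>' using ht by simp
  ultimately show "search_inv L r h t' ?e \<sigma>' mark' cnt'"
    unfolding search_inv_def U'
    using ht ok' h0 u mark1 cnt1 queue1 t' by auto
qed

section \<open>The program\<close>

notation Seq (infixr \<open>;;\<close> 60)

text \<open>Insertion at the front of the list of \<open>u\<close>. As pointers are shifted by one,
  \<open>q\<close> is incremented before it becomes the head; thanks to the shift, zero-filled
  arrays stand for empty lists and need no initialisation.\<close>

definition add_arc :: "string \<Rightarrow> string \<Rightarrow> bool \<Rightarrow> prog" where
  "add_arc u w c =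
     Write ''tgt'' (Reg ''q'') (Reg w) ;; Write ''constr'' (Reg ''q'') (Const (of_bool c)) ;;
     Read ''x'' ''head'' (Reg u) ;; Write ''next'' (Reg ''q'') (Reg ''x'') ;;
     Incr ''q'' ;; Write ''head'' (Reg u) (Reg ''q'')"

definition load_edges :: prog where
  "load_edges =
     Set ''i'' (Const 0) ;;
     While (Less (Reg ''i'') (Reg ''m''))
       (Read ''u'' ''edge_fst'' (Reg ''i'') ;; Read ''w'' ''edge_snd'' (Reg ''i'') ;;
        add_arc ''u'' ''w'' False ;; add_arc ''w'' ''u'' False ;; Incr ''i'')"

text \<open>Reflexive pairs are dropped: a vertex waiting for itself would never see its counter
  reach zero.\<close>

definition load_order :: prog where
  "load_order =
     Set ''i'' (Const 0) ;;
     While (Less (Reg ''i'') (Reg ''p''))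
       (Read ''u'' ''order_fst'' (Reg ''i'') ;; Read ''w'' ''order_snd'' (Reg ''i'') ;;
        If (Eq (Reg ''u'') (Reg ''w'')) Skip
          (add_arc ''u'' ''w'' True ;;
           Read ''c'' ''cnt'' (Reg ''w'') ;; Incr ''c'' ;; Write ''cnt'' (Reg ''w'') (Reg ''c'')) ;;
        Incr ''i'')"

definition enqueue :: "string \<Rightarrow> prog" where
  "enqueue w = Incr ''t'' ;; Write ''sigma'' (Reg ''t'') (Reg w)"

text \<open>If \<open>r\<close> has a proper predecessor, nothing is enqueued; the search then ends
  at once with an empty queue, and no ordering is reported.\<close>

definition start :: prog where
  "start =
     Write ''mark'' (Reg ''r'') (Const 1) ;; Read ''c'' ''cnt'' (Reg ''r'') ;;
     If (Eq (Reg ''c'') (Const 0)) (enqueue ''r'') Skip"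

text \<open>The old mark and counter are read before any write, so that \<open>w\<close> is enqueued
  only when its last missing condition becomes true. The first \<open>Decr\<close> turns the shifted
  pointer into an index.\<close>

definition scan :: prog where
  "scan =
     Decr ''e'' ;; Read ''w'' ''tgt'' (Reg ''e'') ;; Read ''d'' ''constr'' (Reg ''e'') ;;
     Read ''c'' ''cnt'' (Reg ''w'') ;; Read ''b'' ''mark'' (Reg ''w'') ;;
     Read ''e'' ''next'' (Reg ''e'') ;;
     If (Eq (Reg ''d'') (Const 0))
       (Write ''mark'' (Reg ''w'') (Const 1) ;;
        If (Eq (Reg ''b'') (Const 0))
          (If (Eq (Reg ''c'') (Const 0)) (enqueue ''w'') Skip) Skip)
       (Decr ''c'' ;; Write ''cnt'' (Reg ''w'') (Reg ''c'') ;;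
        If (Eq (Reg ''c'') (Const 0))
          (If (Eq (Reg ''b'') (Const 0)) Skip (enqueue ''w'')) Skip)"

definition search :: prog where
  "search =
     While (Less (Reg ''h'') (Reg ''t''))
       (Incr ''h'' ;; Read ''v'' ''sigma'' (Reg ''h'') ;; Read ''e'' ''head'' (Reg ''v'') ;;
        While (Less (Const 0) (Reg ''e'')) scan)"

definition gs_program :: prog where
  "gs_program = load_edges ;; load_order ;; start ;; search ;;
     If (Eq (Reg ''t'') (Reg ''n'')) (Set ''found'' (Const 1)) Skip"

section \<open>Effect and cost of loading the input\<close>

lemma runs_add_arc:
  assumes "linked L s" "u \<notin> {''q'', ''x''}" "w \<notin> {''q'', ''x''}"
  shows "runs (add_arc u w c) s (\<lambda>t s'. t = 6 \<and> linked (L @ [(regs s u, regs s w, c)]) s' \<and>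
     (\<forall>y. y \<notin> {''q'', ''x''} \<longrightarrow> regs s' y = regs s y) \<and>
     (\<forall>a. a \<notin> {''tgt'', ''constr'', ''head'', ''next''} \<longrightarrow> arrs s' a = arrs s a))"
  using assms unfolding add_arc_def linked_def
  by (auto simp: runs_simps nth_append less_Suc_eq)

definition edge_arcs :: "(nat \<times> nat) list \<Rightarrow> arc list" where
  "edge_arcs es = concat (map (\<lambda>(i, j). [(i, j, False), (j, i, False)]) es)"

definition order_arcs :: "(nat \<times> nat) list \<Rightarrow> arc list" where
  "order_arcs ps = map (\<lambda>(i, j). (i, j, True)) (filter (\<lambda>(i, j). i \<noteq> j) ps)"

definition fresh_input :: "nat \<Rightarrow> (nat \<times> nat) list \<Rightarrow> nat \<Rightarrow> (nat \<times> nat) list \<Rightarrow> mstate \<Rightarrow> bool" where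
  "fresh_input n es k ps s \<longleftrightarrow>
     regs s ''n'' = n \<and> regs s ''m'' = length es \<and> regs s ''p'' = length ps \<and> regs s ''r'' = k \<and>
     regs s ''h'' = 0 \<and> regs s ''t'' = 0 \<and> regs s ''e'' = 0 \<and> regs s ''found'' = 0 \<and>
     arrs s ''edge_fst'' = cells (map fst es) \<and> arrs s ''edge_snd'' = cells (map snd es) \<and>
     arrs s ''order_fst'' = cells (map fst ps) \<and> arrs s ''order_snd'' = cells (map snd ps) \<and>
     arrs s ''mark'' = (\<lambda>_. 0)"

definition indegree :: "arc list \<Rightarrow> nat \<Rightarrow> nat" where
  "indegree L w = length (filter (\<lambda>x. tgt x = w \<and> constr x) L)"

lemma fresh_input_initial:
  "fresh_input n es k ps (initial_state n es k ps)" "linked [] (initial_state n es k ps)"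
  "arrs (initial_state n es k ps) ''cnt'' = (\<lambda>_. 0)"
  by (auto simp: fresh_input_def linked_def initial_state_def)

lemma runs_load_edges:
  assumes "fresh_input n es k ps s" "linked [] s" "arrs s ''cnt'' = (\<lambda>_. 0)"
  shows "runs load_edges s (\<lambda>t s'. t \<le> 16 * length es + 2 \<and> fresh_input n es k ps s' \<and>
     linked (edge_arcs es) s' \<and> arrs s' ''cnt'' = (\<lambda>_. 0))"
proof -
  let ?I = "\<lambda>s. regs s ''i'' \<le> length es \<and> fresh_input n es k ps s \<and>
    linked (edge_arcs (take (regs s ''i'') es)) s \<and> arrs s ''cnt'' = (\<lambda>_. 0)"
  \<comment> \<open>A round takes 15 steps: two reads, two insertions of 6 steps each and an
    increment. The loop test makes 16.\<close>
  let ?\<Phi> = "\<lambda>s. 16 * (length es - regs s ''i'')"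
  let ?B = "Read ''u'' ''edge_fst'' (Reg ''i'') ;; Read ''w'' ''edge_snd'' (Reg ''i'') ;;
        add_arc ''u'' ''w'' False ;; add_arc ''w'' ''u'' False ;; Incr ''i''"
  have body: "runs ?B s (\<lambda>t s'. ?I s' \<and> t + 1 + ?\<Phi> s' \<le> ?\<Phi> s)"
    if I: "?I s" and "test_val s (Less (Reg ''i'') (Reg ''m''))" for s
  proof -
    define i where "i = regs s ''i''"
    have i: "i < length es" using that unfolding fresh_input_def i_def by simp
    obtain u w where uw: "es ! i = (u, w)" by fastforce
    have arcs: "edge_arcs (take (Suc i) es) = (edge_arcs (take i es) @ [(u, w, False)]) @ [(w, u, False)]"
      using i uw by (simp add: edge_arcs_def take_Suc_conv_app_nth)
    define s1 where "s1 = set_reg ''w'' w (set_reg ''u'' u s)"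
    have s1: "linked (edge_arcs (take i es)) s1" "regs s1 ''u'' = u" "regs s1 ''w'' = w"
      using I unfolding s1_def i_def linked_def by auto
    have eq: "runs ?B s Q \<longleftrightarrow> runs (add_arc ''u'' ''w'' False) s1
        (\<lambda>t s2. runs (add_arc ''w'' ''u'' False) s2 (\<lambda>t' s3. Q (t + t' + 3) (set_reg ''i'' (regs s3 ''i'' + 1) s3)))" for Q
      using I i uw unfolding s1_def fresh_input_def
      by (simp add: runs_simps cells_def i_def[symmetric] numeral_eq_Suc)
    show ?thesis
      unfolding eq
    proof (rule runs_mono[OF runs_add_arc[OF s1(1)]], simp, simp, elim conjE,
           rule runs_mono[OF runs_add_arc], assumption, simp, simp, elim conjE)
      fix t1 t2 :: nat and s2 s3
      assume 1: "t1 = 6" "\<forall>y. y \<notin> {''q'', ''x''} \<longrightarrow> regs s2 y = regs s1 y"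
        "\<forall>a. a \<notin> {''tgt'', ''constr'', ''head'', ''next''} \<longrightarrow> arrs s2 a = arrs s1 a"
      assume 2: "t2 = 6" "linked ((edge_arcs (take i es) @ [(regs s1 ''u'', regs s1 ''w'', False)]) @
          [(regs s2 ''w'', regs s2 ''u'', False)]) s3"
        "\<forall>y. y \<notin> {''q'', ''x''} \<longrightarrow> regs s3 y = regs s2 y"
        "\<forall>a. a \<notin> {''tgt'', ''constr'', ''head'', ''next''} \<longrightarrow> arrs s3 a = arrs s2 a"
      have r: "regs s3 y = regs s1 y" if "y \<notin> {''q'', ''x''}" for y using that 1 2 by simp
      have a: "arrs s3 y = arrs s1 y" if "y \<notin> {''tgt'', ''constr'', ''head'', ''next''}" for y
        using that 1 2 by simp
      have "fresh_input n es k ps (set_reg ''i'' (regs s3 ''i'' + 1) s3)"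
        using I unfolding fresh_input_def by (simp add: r a s1_def)
      moreover have "regs s3 ''i'' = i" by (simp add: r s1_def i_def)
      moreover have "linked (edge_arcs (take (Suc i) es)) (set_reg ''i'' (Suc i) s3)"
        using 2(2) 1(2) s1 unfolding arcs linked_def by simp
      moreover have "arrs s3 ''cnt'' = (\<lambda>_. 0)" using I by (simp add: a s1_def)
      ultimately show "?I (set_reg ''i'' (regs s3 ''i'' + 1) s3) \<and>
         t1 + t2 + 3 + 1 + ?\<Phi> (set_reg ''i'' (regs s3 ''i'' + 1) s3) \<le> ?\<Phi> s"
        using i 1(1) 2(1) by (simp add: i_def[symmetric])
    qed
  qed
  have "?I (set_reg ''i'' 0 s)"
    using assms by (simp add: fresh_input_def linked_def edge_arcs_def)
  then have "runs (While (Less (Reg ''i'') (Reg ''m'')) ?B) (set_reg ''i'' 0 s) (\<lambda>t s'. ?I s' \<and>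
      \<not> test_val s' (Less (Reg ''i'') (Reg ''m'')) \<and> t + ?\<Phi> s' \<le> ?\<Phi> (set_reg ''i'' 0 s) + 1)"
    by (rule runs_While) (rule body)
  then show ?thesis
    unfolding load_edges_def runs_simps(2,7) operand_val.simps
    by (rule runs_mono) (auto simp: fresh_input_def)
qed

lemma runs_load_order:
  assumes "fresh_input n es k ps s" "linked L s" "arrs s ''cnt'' = indegree L"
  shows "runs load_order s (\<lambda>t s'. t \<le> 14 * length ps + 2 \<and> fresh_input n es k ps s' \<and>
     linked (L @ order_arcs ps) s' \<and> arrs s' ''cnt'' = indegree (L @ order_arcs ps))"
proof -
  let ?L = "\<lambda>i. L @ order_arcs (take i ps)"
  let ?I = "\<lambda>s. regs s ''i'' \<le> length ps \<and> fresh_input n es k ps s \<and>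
    linked (?L (regs s ''i'')) s \<and> arrs s ''cnt'' = indegree (?L (regs s ''i''))"
  \<comment> \<open>The costlier branch takes 13 steps: two reads, the test, an insertion of 6
    steps, three steps for the counter and the increment. The loop test makes 14.\<close>
  let ?\<Phi> = "\<lambda>s. 14 * (length ps - regs s ''i'')"
  let ?B = "Read ''u'' ''order_fst'' (Reg ''i'') ;; Read ''w'' ''order_snd'' (Reg ''i'') ;;
        If (Eq (Reg ''u'') (Reg ''w'')) Skip
          (add_arc ''u'' ''w'' True ;;
           Read ''c'' ''cnt'' (Reg ''w'') ;; Incr ''c'' ;; Write ''cnt'' (Reg ''w'') (Reg ''c'')) ;;
        Incr ''i''"
  have body: "runs ?B s (\<lambda>t s'. ?I s' \<and> t + 1 + ?\<Phi> s' \<le> ?\<Phi> s)"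
    if I: "?I s" and "test_val s (Less (Reg ''i'') (Reg ''p''))" for s
  proof -
    define i where "i = regs s ''i''"
    have i: "i < length ps" using that unfolding fresh_input_def i_def by simp
    obtain u w where uw: "ps ! i = (u, w)" by fastforce
    define s1 where "s1 = set_reg ''w'' w (set_reg ''u'' u s)"
    have s1: "linked (?L i) s1" "regs s1 ''u'' = u" "regs s1 ''w'' = w" "regs s1 ''i'' = i"
      using I unfolding s1_def i_def linked_def by auto
    have input: "arrs s ''order_fst'' i = u" "arrs s ''order_snd'' i = w"
      using I i uw unfolding fresh_input_def by (auto simp: cells_def)
    show ?thesis
    proof (cases "u = w")
      case True
      then have arcs: "?L (Suc i) = ?L i"
        using i uw by (simp add: order_arcs_def take_Suc_conv_app_nth)
      show ?thesis
        using I i input True unfolding runs_simps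
        by (simp add: i_def[symmetric] arcs fresh_input_def linked_def)
    next
      case False
      then have arcs: "?L (Suc i) = ?L i @ [(u, w, True)]"
        using i uw by (simp add: order_arcs_def take_Suc_conv_app_nth)
      define fin where "fin s2 = set_reg ''i'' (Suc (regs s2 ''i'')) (set_cell ''cnt'' (regs s2 ''w'')
          (Suc (arrs s2 ''cnt'' (regs s2 ''w''))) (set_reg ''c'' (Suc (arrs s2 ''cnt'' (regs s2 ''w'')))
          (set_reg ''c'' (arrs s2 ''cnt'' (regs s2 ''w'')) s2)))" for s2
      have eq: "runs ?B s Q \<longleftrightarrow> runs (add_arc ''u'' ''w'' True) s1 (\<lambda>t s2. Q (t + 7) (fin s2))" for Q
        using False unfolding s1_def fin_def
        by (simp add: runs_simps i_def[symmetric] input numeral_eq_Suc)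
      show ?thesis
        unfolding eq
      proof (rule runs_mono[OF runs_add_arc[OF s1(1)]], simp, simp, elim conjE)
        fix t :: nat and s2
        assume t: "t = 6" and l: "linked (?L i @ [(regs s1 ''u'', regs s1 ''w'', True)]) s2"
          and "\<forall>y. y \<notin> {''q'', ''x''} \<longrightarrow> regs s2 y = regs s1 y"
          and "\<forall>a. a \<notin> {''tgt'', ''constr'', ''head'', ''next''} \<longrightarrow> arrs s2 a = arrs s1 a"
        then have r: "\<And>y. y \<notin> {''q'', ''x''} \<Longrightarrow> regs s2 y = regs s1 y"
          and a: "\<And>a. a \<notin> {''tgt'', ''constr'', ''head'', ''next''} \<Longrightarrow> arrs s2 a = arrs s1 a"
          by blast+
        have "fresh_input n es k ps (fin s2)"
          using I unfolding fresh_input_def by (simp add: r a s1_def fin_def)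
        moreover have "regs (fin s2) ''i'' = Suc i" by (simp add: r s1 fin_def)
        moreover have "linked (?L (Suc i)) (fin s2)"
          using l s1 unfolding arcs linked_def by (simp add: fin_def)
        moreover have "arrs (fin s2) ''cnt'' = indegree (?L (Suc i))"
        proof -
          have "arrs s2 ''cnt'' = indegree (?L i)" using I by (simp add: a s1_def i_def)
          then show ?thesis
            unfolding arcs by (auto simp: fin_def r s1 indegree_def)
        qed
        ultimately show "?I (fin s2) \<and> t + 7 + 1 + ?\<Phi> (fin s2) \<le> ?\<Phi> s"
          using i t by (simp add: i_def[symmetric])
      qed
    qed
  qed
  have "?I (set_reg ''i'' 0 s)"
    using assms by (simp add: fresh_input_def linked_def order_arcs_def)
  then have "runs (While (Less (Reg ''i'') (Reg ''p'')) ?B) (set_reg ''i'' 0 s) (\<lambda>t s'. ?I s' \<and>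
      \<not> test_val s' (Less (Reg ''i'') (Reg ''p'')) \<and> t + ?\<Phi> s' \<le> ?\<Phi> (set_reg ''i'' 0 s) + 1)"
    by (rule runs_While) (rule body)
  then show ?thesis
    unfolding load_order_def runs_simps(2,7) operand_val.simps
    by (rule runs_mono) (auto simp: fresh_input_def)
qed

section \<open>Effect and cost of the search\<close>

definition searching :: "arc list \<Rightarrow> nat \<Rightarrow> nat \<Rightarrow> mstate \<Rightarrow> bool" where
  "searching L n r s \<longleftrightarrow> linked L s \<and> regs s ''n'' = n \<and> regs s ''found'' = 0 \<and>
     search_inv L r (regs s ''h'') (regs s ''t'') (regs s ''e'')
       (arrs s ''sigma'') (arrs s ''mark'') (arrs s ''cnt'')"

definition pending :: "arc list \<Rightarrow> mstate \<Rightarrow> nat" where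
  "pending L s = card (pend L (arrs s ''sigma'') (regs s ''h'') (regs s ''e''))"

lemma runs_start:
  assumes "fresh_input n es r ps s" "linked L s" "arrs s ''cnt'' = indegree L"
  shows "runs start s (\<lambda>t s'. t \<le> 5 \<and> searching L n r s' \<and> regs s' ''h'' = 0 \<and> regs s' ''e'' = 0)"
proof -
  \<comment> \<open>Nothing has been dequeued, so every arc is pending and the counters filled while
    loading already satisfy the invariant.\<close>
  have pend: "pend L \<sigma> 0 0 = {..<length L}" for \<sigma> unfolding pend_def by auto
  have cnt: "indegree L w = card {a. a < length L \<and> tgt (L ! a) = w \<and> constr (L ! a)}" for w
    by (auto simp: indegree_def length_filter_conv_card intro: arg_cong[where f = card])
  have preds: "(u, r, True) \<notin> set L" if "indegree L r = 0" for u
    using that by (auto simp: indegree_def filter_empty_conv)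
  show ?thesis
    using assms preds unfolding start_def enqueue_def fresh_input_def searching_def search_inv_def
    by (auto simp: runs_simps linked_def prefix_ok_def pend cnt[symmetric])
qed

text \<open>The 13 steps are those of the longest path: 7 up to the first test inclusive, then a
  decrement, a write, two tests and an enqueue of 2 steps.\<close>

lemma runs_scan:
  assumes S: "searching L n r s" and "regs s ''e'' \<noteq> 0"
  shows "runs scan s (\<lambda>t s'. t \<le> 13 \<and> searching L n r s' \<and> regs s' ''h'' = regs s ''h'' \<and>
     pending L s = Suc (pending L s'))"
proof -
  obtain a where a: "regs s ''e'' = Suc a" using assms(2) by (cases "regs s ''e''") auto
  obtain u w c where arc: "L ! a = (u, w, c)" using prod_cases3 by blast
  have inv: "search_inv L r (regs s ''h'') (regs s ''t'') (Suc a)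
       (arrs s ''sigma'') (arrs s ''mark'') (arrs s ''cnt'')"
    using S a unfolding searching_def by simp
  then have "a < length L" unfolding search_inv_def by simp
  then have cell: "arrs s ''tgt'' a = w" "arrs s ''constr'' a = of_bool c"
    "arrs s ''next'' a = link (take a L) u"
    using S arc unfolding searching_def linked_def by auto
  note step = search_inv_scan[OF inv arc refl refl refl refl refl]
  show ?thesis
    using S step unfolding searching_def scan_def enqueue_def pending_def
    by (cases c; cases "arrs s ''mark'' w = 0"; cases "arrs s ''cnt'' w = 0";
        cases "arrs s ''cnt'' w = Suc 0")
      (simp_all add: runs_simps linked_def a cell)
qed

text \<open>Every queued vertex is marked, hence is \<open>r\<close> or the target of an arc;
  injectivity then bounds the queue length. It follows that \<open>n - h\<close> really decreases
  with each dequeue.\<close>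

lemma queue_le:
  assumes "search_inv L r h t e \<sigma> mark cnt" "r < n" "\<forall>x\<in>set L. tgt x < n"
  shows "\<sigma> ` {1..t} \<subseteq> {..<n}" "t \<le> n"
proof -
  have "mark w \<noteq> 0 \<Longrightarrow> w < n" for w
    using assms nth_mem unfolding search_inv_def by metis
  then show sub: "\<sigma> ` {1..t} \<subseteq> {..<n}"
    using assms(1) unfolding search_inv_def by blast
  have "inj_on \<sigma> {1..t}" using assms(1) unfolding search_inv_def prefix_ok_def by blast
  from card_inj_on_le[OF this sub] show "t \<le> n" by simp
qed

lemma runs_search:
  assumes "searching L n r s" "regs s ''h'' = 0" "regs s ''e'' = 0"
    and "r < n" "\<forall>x\<in>set L. tgt x < n"
  shows "runs search s (\<lambda>t s'. t \<le> 14 * length L + 5 * n + 1 \<and> searching L n r s' \<and>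
     regs s' ''h'' = regs s' ''t'' \<and> regs s' ''e'' = 0)"
proof -
  let ?I = "\<lambda>s. searching L n r s \<and> regs s ''e'' = 0"
  \<comment> \<open>A scan costs at most 13 steps plus the inner test. A dequeue costs 5: three
    instructions, the failing inner test and the outer test.\<close>
  let ?\<Phi> = "\<lambda>s. 14 * pending L s + 5 * (n - regs s ''h'')"
  have body: "runs (Incr ''h'' ;; Read ''v'' ''sigma'' (Reg ''h'') ;; Read ''e'' ''head'' (Reg ''v'') ;;
      While (Less (Const 0) (Reg ''e'')) scan) s (\<lambda>t s'. ?I s' \<and> t + 1 + ?\<Phi> s' \<le> ?\<Phi> s)"
    if I: "?I s" and "test_val s (Less (Reg ''h'') (Reg ''t''))" for s
  proof -
    define h where "h = regs s ''h''"
    have ht: "h < regs s ''t''" using that unfolding h_def by simp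
    have inv: "search_inv L r h (regs s ''t'') 0 (arrs s ''sigma'') (arrs s ''mark'') (arrs s ''cnt'')"
      using I unfolding searching_def h_def by auto
    have hn: "h < n" using ht queue_le(2)[OF inv assms(4,5)] by simp
    define v where "v = arrs s ''sigma'' (Suc h)"
    define s1 where "s1 = set_reg ''e'' (link L v) (set_reg ''v'' v (set_reg ''h'' (Suc h) s))"
    have s1: "searching L n r s1"
      using I search_inv_dequeue[OF inv ht] unfolding searching_def linked_def
      by (simp add: s1_def v_def)
    have "inj_on (arrs s ''sigma'') {1..regs s ''t''}"
      using inv unfolding search_inv_def prefix_ok_def by blast
    from pend_dequeue[OF this ht, of L] I have pending: "pending L s1 = pending L s"
      by (simp add: s1_def pending_def v_def h_def)
    let ?J = "\<lambda>s. searching L n r s \<and> regs s ''h'' = Suc h"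
    have "runs scan s (\<lambda>t s'. ?J s' \<and> t + 1 + 14 * pending L s' \<le> 14 * pending L s)"
      if "?J s" "test_val s (Less (Const 0) (Reg ''e''))" for s
      by (rule runs_mono[OF runs_scan[of L n r s]]) (use that in auto)
    moreover have "?J s1" using s1 by (simp add: s1_def)
    ultimately have "runs (While (Less (Const 0) (Reg ''e'')) scan) s1 (\<lambda>t s'. ?J s' \<and>
        \<not> test_val s' (Less (Const 0) (Reg ''e'')) \<and> t + 14 * pending L s' \<le> 14 * pending L s1 + 1)"
      using runs_While[where I = ?J and \<Phi> = "\<lambda>s. 14 * pending L s"] by blast
    then have "runs (While (Less (Const 0) (Reg ''e'')) scan) s1
        (\<lambda>t s'. ?I s' \<and> 1 + (1 + (1 + t)) + 1 + ?\<Phi> s' \<le> ?\<Phi> s)"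
      by (rule runs_mono) (use hn in \<open>auto simp: pending h_def[symmetric]\<close>)
    moreover have "arrs s ''head'' = link L" using I unfolding searching_def linked_def by simp
    ultimately show ?thesis
      unfolding runs_simps by (simp add: h_def[symmetric] v_def[symmetric] s1_def[symmetric])
  qed
  let ?b = "Less (Reg ''h'') (Reg ''t'')"
  have "?I s" using assms by simp
  then have "runs search s (\<lambda>t s'. ?I s' \<and> \<not> test_val s' ?b \<and> t + ?\<Phi> s' \<le> ?\<Phi> s + 1)"
    unfolding search_def by (rule runs_While) (rule body)
  moreover have "pending L s \<le> length L"
    using card_mono[OF _ pend_subset] unfolding pending_def by fastforce
  ultimately show ?thesis
    by (elim runs_mono) (use assms(2) in \<open>auto simp: searching_def search_inv_def\<close>)
qed

section \<open>Correctness\<close>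

lemma mem_edge_arcs: "(u, w, c) \<in> set (edge_arcs es) \<longleftrightarrow> \<not> c \<and> ((u, w) \<in> set es \<or> (w, u) \<in> set es)"
  unfolding edge_arcs_def by auto

lemma mem_order_arcs: "(u, w, c) \<in> set (order_arcs ps) \<longleftrightarrow> c \<and> (u, w) \<in> set ps \<and> u \<noteq> w"
  unfolding order_arcs_def by auto

lemma length_edge_arcs: "length (edge_arcs es) = 2 * length es"
  unfolding edge_arcs_def by (induction es) auto

lemma length_order_arcs: "length (order_arcs ps) \<le> length ps"
  unfolding order_arcs_def by simp

text \<open>All queued vertices have been dequeued, so an arc is scanned exactly if its source lies
  in \<open>S\<close>. The invariant thereby becomes a fixed-point equation: \<open>S\<close>
  consists of the vertices eligible relative to \<open>S\<close>.\<close>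

lemma search_inv_final:
  assumes inv: "search_inv L r t t 0 \<sigma> mark cnt" and S: "S = \<sigma> ` {1..t}"
  shows "w \<in> S \<longleftrightarrow> (w = r \<or> (\<exists>u\<in>S. (u, w, False) \<in> set L)) \<and> (\<forall>u. (u, w, True) \<in> set L \<longrightarrow> u \<in> S)"
proof -
  have pend: "pend L \<sigma> t 0 = {a. a < length L \<and> src (L ! a) \<notin> S}"
    unfolding pend_def S by simp
  have "w \<in> S \<longleftrightarrow> mark w \<noteq> 0 \<and> cnt w = 0"
    using inv unfolding search_inv_def S by (elim conjE allE[where x = w])
  moreover have "mark w \<noteq> 0 \<longleftrightarrow> w = r \<or> (\<exists>a<length L. a \<notin> pend L \<sigma> t 0 \<and> tgt (L ! a) = w \<and> \<not> constr (L ! a))"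
    using inv unfolding search_inv_def by (elim conjE allE[where x = w])
  moreover have "(\<exists>a<length L. a \<notin> pend L \<sigma> t 0 \<and> tgt (L ! a) = w \<and> \<not> constr (L ! a)) \<longleftrightarrow>
      (\<exists>u\<in>S. (u, w, False) \<in> set L)"
    unfolding pend by (auto simp: in_set_conv_nth prod_eq_iff)
  moreover have "cnt w = card {a \<in> pend L \<sigma> t 0. tgt (L ! a) = w \<and> constr (L ! a)}"
    using inv unfolding search_inv_def by (elim conjE allE[where x = w])
  then have "cnt w = 0 \<longleftrightarrow> {a \<in> pend L \<sigma> t 0. tgt (L ! a) = w \<and> constr (L ! a)} = {}"
    by simp
  moreover have "\<dots> \<longleftrightarrow> (\<forall>u. (u, w, True) \<in> set L \<longrightarrow> u \<in> S)"
    unfolding pend by (auto simp: in_set_conv_nth prod_eq_iff)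
  ultimately show ?thesis by simp
qed

lemma runs_gs_program:
  fixes es ps k n
  defines "L \<equiv> edge_arcs es @ order_arcs ps"
  assumes "k < n" "\<forall>x\<in>set L. tgt x < n"
  shows "runs gs_program (initial_state n es k ps) (\<lambda>t s.
     t \<le> 50 * (n + length es + length ps) \<and>
     search_inv L k (regs s ''t'') (regs s ''t'') 0 (arrs s ''sigma'') (arrs s ''mark'') (arrs s ''cnt'') \<and>
     regs s ''found'' = (if regs s ''t'' = n then 1 else 0))"
proof -
  have "length L \<le> 2 * length es + length ps"
    using length_order_arcs[of ps] by (simp add: L_def length_edge_arcs)
  moreover have "indegree (edge_arcs es) = (\<lambda>_. 0)"
    by (intro ext) (auto simp: indegree_def filter_empty_conv mem_edge_arcs)
  ultimately show ?thesis
    \<comment> \<open>The phases add up to at most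
      \<open>44 * length es + 28 * length ps + 5 * n + 12\<close> steps; as \<open>n\<close> is
      positive, \<open>50 * n\<close> absorbs the constant.\<close>
    using \<open>k < n\<close> unfolding gs_program_def runs_simps
    apply (intro runs_mono[OF runs_load_edges[OF fresh_input_initial]])
    apply (elim conjE)
    apply (rule runs_mono[OF runs_load_order[where L = "edge_arcs es"]], assumption, assumption, simp)
    apply (elim conjE)
    apply (rule runs_mono[OF runs_start[where L = L]], assumption, simp add: L_def, simp add: L_def)
    apply (elim conjE)
    apply (rule runs_mono[OF runs_search[where L = L and n = n and r = k]], assumption+, rule assms(3))
    apply (auto simp: searching_def split: if_splits)
    done
qed

section \<open>Transfer to orderings of the graph\<close>

lemma parcs_of_uedges:
  assumes "pair_graph G" "{u, w} \<in> uedges G"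
  shows "(u, w) \<in> parcs G"
proof -
  interpret pair_graph G by fact
  from assms(2) obtain a b where "{u, w} = {a, b}" "(a, b) \<in> parcs G"
    unfolding uedges_def by blast
  then show ?thesis using arcs_symmetric by (auto simp: doubleton_eq_iff)
qed

text \<open>The first vertex of an ordering outside \<open>S\<close> is \<open>r\<close> or has a
  neighbour in \<open>S\<close>, and its proper predecessors lie in \<open>S\<close>, so closedness
  forces it into \<open>S\<close>. By the assumption on the range of \<open>\<pi>\<close>, each
  predecessor occupies some position.\<close>

lemma no_ordering:
  assumes S: "S \<subset> pverts G"
    and closed: "\<And>w. w \<in> pverts G \<Longrightarrow> w = r \<or> (\<exists>u\<in>S. (u, w) \<in> parcs G) \<Longrightarrow>
      (\<And>u. (u, w) \<in> \<pi> \<Longrightarrow> u \<noteq> w \<Longrightarrow> u \<in> S) \<Longrightarrow> w \<in> S"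
    and \<pi>: "\<pi> \<subseteq> pverts G \<times> pverts G"
  shows "\<not> (GS_ordering G \<tau> \<and> \<tau> 1 = r \<and> linear_extension G \<pi> \<tau>)"
proof
  assume *: "GS_ordering G \<tau> \<and> \<tau> 1 = r \<and> linear_extension G \<pi> \<tau>"
  let ?n = "card (pverts G)"
  from * have bij: "bij_betw \<tau> {1..?n} (pverts G)"
    unfolding GS_ordering_def vertex_ordering_def by blast
  then have im: "\<tau> ` {1..?n} = pverts G" by (rule bij_betw_imp_surj_on)
  let ?P = "\<lambda>i. i \<in> {1..?n} \<and> \<tau> i \<notin> S"
  from S obtain v where "v \<in> pverts G" "v \<notin> S" by blast
  moreover from this(1) have "v \<in> \<tau> ` {1..?n}" using im by simp
  ultimately obtain i0 where i0: "?P i0" by blast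
  define i where "i = (LEAST i. ?P i)"
  have i: "?P i" unfolding i_def by (rule LeastI[of ?P, OF i0])
  have least: "\<not> ?P j" if "j < i" for j
    using that not_less_Least[of j ?P] unfolding i_def by blast
  have before: "\<tau> j \<in> S" if "j \<in> {1..<i}" for j
    using least[of j] that i by auto
  have "\<tau> i \<in> S"
  proof (rule closed)
    show "\<tau> i \<in> pverts G" using i im by blast
    show "\<tau> i = r \<or> (\<exists>u\<in>S. (u, \<tau> i) \<in> parcs G)"
    proof (cases "i = 1")
      case False
      then have "i \<in> {2..?n}" using i by auto
      with * obtain j where "j \<in> {1..<i}" "(\<tau> j, \<tau> i) \<in> parcs G"
        unfolding GS_ordering_def by blast
      with before show ?thesis by blast
    qed (use * in simp)
    fix u assume u: "(u, \<tau> i) \<in> \<pi>" "u \<noteq> \<tau> i"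
    then obtain j where j: "j \<in> {1..?n}" "u = \<tau> j" using \<pi> im by blast
    with * u i have "j < i" unfolding linear_extension_def by blast
    with j before show "u \<in> S" by auto
  qed
  with i show False by blast
qed

text \<open>The search yields predecessors as members of an earlier segment; injectivity of
  \<open>\<sigma>\<close> turns this into a comparison of positions.\<close>

lemma found_ordering:
  assumes "vertex_ordering G \<sigma>"
    and "\<And>i. i \<in> {2..card (pverts G)} \<Longrightarrow> \<exists>j\<in>{1..<i}. (\<sigma> j, \<sigma> i) \<in> parcs G"
    and "\<And>i u. i \<in> {1..card (pverts G)} \<Longrightarrow> (u, \<sigma> i) \<in> \<pi> \<Longrightarrow> u \<noteq> \<sigma> i \<Longrightarrow> u \<in> \<sigma> ` {1..<i}"
  shows "GS_ordering G \<sigma>" "linear_extension G \<pi> \<sigma>"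
proof -
  show "GS_ordering G \<sigma>" using assms unfolding GS_ordering_def by blast
  have inj: "inj_on \<sigma> {1..card (pverts G)}"
    using assms(1) unfolding vertex_ordering_def by (rule bij_betw_imp_inj_on)
  have "i < j" if ij: "i \<in> {1..card (pverts G)}" "j \<in> {1..card (pverts G)}"
    "(\<sigma> i, \<sigma> j) \<in> \<pi>" "\<sigma> i \<noteq> \<sigma> j" for i j
  proof -
    from assms(3)[OF ij(2-4)] obtain l where l: "l \<in> {1..<j}" "\<sigma> i = \<sigma> l" by blast
    with ij(2) have "l \<in> {1..card (pverts G)}" by auto
    with inj l(2) ij(1) have "i = l" by (auto dest: inj_onD)
    with l show ?thesis by simp
  qed
  with assms(1) show "linear_extension G \<pi> \<sigma>" unfolding linear_extension_def by blast
qed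

text \<open>The search deals with numbers and arcs of \<open>L\<close>, the claim with vertices,
  \<open>parcs G\<close> and \<open>\<pi>\<close>; the bijection taking \<open>i\<close> to
  \<open>vs ! i\<close> carries one to the other.\<close>

lemma gs_program_correct:
  assumes "pair_graph G" "encodes vs es k ps G r \<pi>"
  shows "\<exists>t s. exec gs_program (initial_state (card (pverts G)) es k ps) t s \<and>
    t \<le> 50 * (card (pverts G) + card (uedges G) + card \<pi>) \<and>
    ((\<exists>\<sigma>. outputs s vs \<sigma> \<and> GS_ordering G \<sigma> \<and> \<sigma> 1 = r \<and> linear_extension G \<pi> \<sigma>) \<or>
     (reports_none s \<and> \<not> (\<exists>\<sigma>. GS_ordering G \<sigma> \<and> \<sigma> 1 = r \<and> linear_extension G \<pi> \<sigma>)))"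
proof -
  define n where "n = length vs"
  let ?v = "\<lambda>i. vs ! i"
  from assms(2) have vs: "distinct vs" "set vs = pverts G"
    and es: "set es \<subseteq> {..<n} \<times> {..<n}" "distinct (map (\<lambda>(i, j). {?v i, ?v j}) es)"
      "(\<lambda>(i, j). {?v i, ?v j}) ` set es = uedges G"
    and k: "k < n" "?v k = r"
    and ps: "set ps \<subseteq> {..<n} \<times> {..<n}" "distinct ps" "(\<lambda>(i, j). (?v i, ?v j)) ` set ps = \<pi>"
    unfolding encodes_def n_def by auto
  have n: "card (pverts G) = n" using vs distinct_card n_def by metis
  have inj: "inj_on ?v {..<n}"
    using vs(1) unfolding n_def by (simp add: inj_on_nth)
  have im: "?v ` {..<n} = pverts G"
    using vs(2) unfolding n_def by (metis atLeast_upt list.set_map map_nth set_upt atLeast0LessThan)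
  \<comment> \<open>The entries are distinct as unordered pairs, so the list is as long as there are
    edges, not arcs.\<close>
  have m: "card (uedges G) = length es"
    using distinct_card[OF es(2)] es(3) by simp
  have "inj_on (\<lambda>(i, j). (?v i, ?v j)) (set ps)"
    using ps(1) by (intro inj_onI) (auto dest!: inj_onD[OF inj] subsetD[OF ps(1)])
  then have p: "card \<pi> = length ps"
    using card_image distinct_card[OF ps(2)] ps(3) by metis
  define L where "L = edge_arcs es @ order_arcs ps"
  have memE: "(u, w, False) \<in> set L \<longleftrightarrow> (u, w) \<in> set es \<or> (w, u) \<in> set es" for u w
    unfolding L_def by (simp add: mem_edge_arcs mem_order_arcs)
  have memO: "(u, w, True) \<in> set L \<longleftrightarrow> (u, w) \<in> set ps \<and> u \<noteq> w" for u w
    unfolding L_def by (simp add: mem_edge_arcs mem_order_arcs)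
  have L_less: "u < n \<and> w < n" if "(u, w, c) \<in> set L" for u w c
    using that es(1) ps(1) by (cases c) (auto simp: memE memO)
  \<comment> \<open>Only one orientation of each edge is in \<open>es\<close>, but \<open>L\<close>
    contains both, so comparing unordered pairs suffices.\<close>
  have edge: "(?v u, ?v w) \<in> parcs G \<longleftrightarrow> (u, w, False) \<in> set L" if "u < n" "w < n" for u w
  proof
    assume "(?v u, ?v w) \<in> parcs G"
    then have "{?v u, ?v w} \<in> uedges G" unfolding uedges_def by blast
    then obtain i j where ij: "(i, j) \<in> set es" "{?v u, ?v w} = {?v i, ?v j}"
      using es(3) by (smt (verit) case_prod_conv imageE surj_pair)
    have "i < n" "j < n" using ij(1) es(1) by auto
    with ij(2) that inj have "u = i \<and> w = j \<or> u = j \<and> w = i"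
      by (auto simp: doubleton_eq_iff dest: inj_onD)
    with ij(1) show "(u, w, False) \<in> set L" unfolding memE by blast
  next
    assume "(u, w, False) \<in> set L"
    then have "{?v u, ?v w} \<in> uedges G"
      unfolding memE es(3)[symmetric] by (force simp: insert_commute)
    then show "(?v u, ?v w) \<in> parcs G" by (rule parcs_of_uedges[OF assms(1)])
  qed
  have order: "(?v u, ?v w) \<in> \<pi> \<and> ?v u \<noteq> ?v w \<longleftrightarrow> (u, w, True) \<in> set L" if "u < n" "w < n" for u w
  proof -
    have "(u, w) \<in> set ps" if "(?v u, ?v w) \<in> \<pi>"
    proof -
      from that obtain i j where ij: "(i, j) \<in> set ps" "?v u = ?v i" "?v w = ?v j"
        unfolding ps(3)[symmetric] by auto
      with ps(1) have "i < n" "j < n" by auto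
      with ij \<open>u < n\<close> \<open>w < n\<close> inj have "u = i" "w = j" by (auto dest: inj_onD)
      with ij show ?thesis by simp
    qed
    then have "(?v u, ?v w) \<in> \<pi> \<longleftrightarrow> (u, w) \<in> set ps"
      unfolding ps(3)[symmetric] by force
    moreover have "?v u = ?v w \<longleftrightarrow> u = w" using that inj by (auto dest: inj_onD)
    ultimately show ?thesis unfolding memO by simp
  qed
  have \<pi>: "\<pi> \<subseteq> pverts G \<times> pverts G"
    using ps(1,3) im by force
  have tgts: "\<forall>x\<in>set L. tgt x < n" using L_less by (metis prod.collapse)
  from runs_gs_program[OF k(1) tgts[unfolded L_def], folded L_def]
  obtain t s q mark cnt where run: "exec gs_program (initial_state n es k ps) t s"
    and t: "t \<le> 50 * (n + length es + length ps)"
    and inv: "search_inv L k q q 0 (arrs s ''sigma'') mark cnt"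
    and found: "regs s ''found'' = (if q = n then 1 else 0)"
    unfolding runs_def by blast
  define \<sigma> where "\<sigma> = arrs s ''sigma''"
  have sub: "\<sigma> ` {1..q} \<subseteq> {..<n}" and qn: "q \<le> n"
    using queue_le[OF inv k(1) tgts] by (simp_all add: \<sigma>_def)
  have ok: "prefix_ok L k q \<sigma>" using inv unfolding search_inv_def \<sigma>_def by blast
  have "(\<exists>\<sigma>. outputs s vs \<sigma> \<and> GS_ordering G \<sigma> \<and> \<sigma> 1 = r \<and> linear_extension G \<pi> \<sigma>) \<or>
     (reports_none s \<and> \<not> (\<exists>\<sigma>. GS_ordering G \<sigma> \<and> \<sigma> 1 = r \<and> linear_extension G \<pi> \<sigma>))"
  proof (cases "q = n")
    case True
    have less: "\<sigma> i < n" if "i \<in> {1..n}" for i using sub that True by blast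
    have inj_\<sigma>: "inj_on \<sigma> {1..n}" using ok True unfolding prefix_ok_def by blast
    then have "\<sigma> ` {1..n} = {..<n}"
      using sub True by (intro card_subset_eq) (simp_all add: card_image)
    then have bij: "bij_betw \<sigma> {1..n} {..<n}" using inj_\<sigma> unfolding bij_betw_def by blast
    define \<tau> where "\<tau> i = ?v (\<sigma> i)" for i
    have "bij_betw ?v {..<n} (pverts G)" using inj im unfolding bij_betw_def by blast
    from bij_betw_trans[OF bij this] have vo: "vertex_ordering G \<tau>"
      unfolding vertex_ordering_def n \<tau>_def comp_def .
    have E: "\<exists>j\<in>{1..<i}. (\<tau> j, \<tau> i) \<in> parcs G" if i: "i \<in> {2..card (pverts G)}" for i
    proof -
      have "i \<in> {1..q}" "i \<noteq> 1" using i True n by auto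
      with ok obtain j where j: "j \<in> {1..<i}" "(\<sigma> j, \<sigma> i, False) \<in> set L"
        unfolding prefix_ok_def by metis
      then show ?thesis using edge L_less[OF j(2)] unfolding \<tau>_def by blast
    qed
    have O: "u \<in> \<tau> ` {1..<i}" if i: "i \<in> {1..card (pverts G)}" and u: "(u, \<tau> i) \<in> \<pi>" "u \<noteq> \<tau> i" for i u
    proof -
      obtain a where a: "a < n" "u = ?v a" using u(1) \<pi> im by blast
      have "i \<in> {1..n}" using i n by simp
      then have "(a, \<sigma> i, True) \<in> set L" using order[OF a(1) less] u a(2) unfolding \<tau>_def by blast
      with ok \<open>i \<in> {1..n}\<close> True have "a \<in> \<sigma> ` {1..<i}" unfolding prefix_ok_def by blast
      with a(2) show ?thesis unfolding \<tau>_def by blast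
    qed
    have "1 \<in> {1..q}" using k(1) True by simp
    with ok have "\<sigma> 1 = k" unfolding prefix_ok_def by metis
    then have "\<tau> 1 = r" using k(2) by (simp add: \<tau>_def)
    moreover have "outputs s vs \<tau>"
      using found True less unfolding outputs_def \<tau>_def n_def[symmetric] \<sigma>_def by simp
    ultimately show ?thesis using found_ordering[OF vo E O] by blast
  next
    case False
    define S where "S = \<sigma> ` {1..q}"
    note fin = search_inv_final[OF inv S_def[unfolded \<sigma>_def]]
    have "card S \<le> q" using card_image_le[of "{1..q}" \<sigma>] by (simp add: S_def)
    then have "S \<noteq> {..<n}" using False qn by auto
    with sub have "S \<subset> {..<n}" unfolding S_def by blast
    then have "?v ` S \<subset> pverts G"
      using inj_on_image_eq_iff[OF inj, of S "{..<n}"] im by blast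
    \<comment> \<open>Pulled back to numbers, closedness of the image of \<open>S\<close> is the
      right-to-left direction of \<open>fin\<close>.\<close>
    moreover have "w \<in> ?v ` S"
      if w: "w \<in> pverts G" and reach: "w = r \<or> (\<exists>u\<in>?v ` S. (u, w) \<in> parcs G)"
        and preds: "\<And>u. (u, w) \<in> \<pi> \<Longrightarrow> u \<noteq> w \<Longrightarrow> u \<in> ?v ` S" for w
    proof -
      obtain a where a: "a < n" "w = ?v a" using w im by blast
      have S_n: "S \<subseteq> {..<n}" using sub S_def by blast
      have "a = k \<or> (\<exists>u\<in>S. (u, a, False) \<in> set L)"
        using reach
      proof
        assume "w = r"
        then show ?thesis using a k inj by (auto dest: inj_onD)
      next
        assume "\<exists>u\<in>?v ` S. (u, w) \<in> parcs G"
        then obtain u where "u \<in> S" "(?v u, ?v a) \<in> parcs G" using a by blast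
        moreover have "u < n" using \<open>u \<in> S\<close> S_n by blast
        ultimately show ?thesis using edge a by blast
      qed
      moreover have "u \<in> S" if u: "(u, a, True) \<in> set L" for u
      proof -
        have "u < n" using L_less[OF u] by blast
        with order[OF this a(1)] u preds a(2) have "?v u \<in> ?v ` S" by blast
        with inj_on_image_mem_iff[OF inj _ S_n] \<open>u < n\<close> show ?thesis by blast
      qed
      ultimately have "a \<in> S" using fin[of a] by blast
      with a(2) show ?thesis by blast
    qed
    ultimately have "\<not> (GS_ordering G \<tau> \<and> \<tau> 1 = r \<and> linear_extension G \<pi> \<tau>)" for \<tau>
      using no_ordering[OF _ _ \<pi>, of "?v ` S" r \<tau>] by blast
    moreover have "reports_none s" using found False unfolding reports_none_def by simp
    ultimately show ?thesis by blast
  qed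
  with run t show ?thesis unfolding n m p by blast
qed

theorem theorem1:
  "\<exists>(P :: prog) (C :: nat).
     \<forall>(G :: nat pair_pre_digraph) (r :: nat) (\<pi> :: nat rel)
      (vs :: nat list) (es :: (nat \<times> nat) list) (k :: nat) (ps :: (nat \<times> nat) list).
       pair_graph G \<and> connected (with_proj G) \<and> r \<in> pverts G \<and> partial_order_on (pverts G) \<pi> \<and>
       encodes vs es k ps G r \<pi> \<longrightarrow>
       (\<exists>t s. exec P (initial_state (card (pverts G)) es k ps) t s \<and>
          t \<le> C * (card (pverts G) + card (uedges G) + card \<pi>) \<and>
          ((\<exists>\<sigma>. outputs s vs \<sigma> \<and> GS_ordering G \<sigma> \<and> \<sigma> 1 = r \<and> linear_extension G \<pi> \<sigma>) \<or>
           (reports_none s \<and>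
              \<not> (\<exists>\<sigma>. GS_ordering G \<sigma> \<and> \<sigma> 1 = r \<and> linear_extension G \<pi> \<sigma>))))"
  by (rule exI[of _ gs_program], rule exI[of _ 50], intro allI impI, elim conjE, rule gs_program_correct)

end
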